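(* Let $\Omega\subset\mathbb{R}^N$ be open, let $f\in C(\Omega)$ satisfy $f\le 0$ in $\Omega$, and set $\Gamma=\{x\in\Omega : f(x)=0\}$. Let $k\in\mathbb{N}$ with $1\le k<N$ and let $F$ be either $\lambda_k$ or $\mathcal{P}^-_k$. Let $u\in\mathrm{LSC}(\overline\Omega)$ be a viscosity supersolution of $F(D^2u)=f$ in $\Omega$ satisfying $u\ge 0$ in $\Omega$. If one of the following conditions holds, then $u$ cannot achieve its minimum inside $\Omega$: (i) $\Gamma$ consists of isolated points. (ii) There exists $\delta>0$ such that $\Gamma\subset\Omega_\delta:=\{x\in\Omega : \operatorname{dist}(x,\partial\Omega)>\delta\}$. (iii) $F=\lambda_k$ and for any $x\in\Gamma$ there exist positive numbers $r_1=r_1(x)$, $r_2=r_2(x)$, an integer $h=h(x)$ with $1\le h\le k-1$, and an orthogonal $N\times N$ matrix $O=O(x)$ such that $$\Big(x+O\big(\overline B_{r_1}^h\times\partial B_{r_2}^{N-h}\big)\Big)\cap\Gamma=\emptyset\quad\text{and}\quad x+O\big(\overline B_{r_1}^h\times\overline B_{r_2}^{N-h}\big)\subset\Omega.$$ (iv) $F=\mathcal{P}^-_k$ and for any $x\in\Gamma$ there exist positive numbers $r_1=r_1(x)$, $r_2=r_2(x)$, an integer $h=h(x)$ with $1\le h\le k-1$, and an orthogonal $N\times N$ matrix $O=O(x)$ such that $\left(\frac{r_2}{r_1}\right)^2<\frac{k}{h}-1$, $$\Big(x+O\big(\overline B_{r_1}^h\times\partial B_{r_2}^{N-h}\big)\Big)\cap\Gamma=\emptyset\quad\text{and}\quad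 x+O\big(\overline B_{r_1}^h\times\overline B_{r_2}^{N-h}\big)\subset\Omega.$$
   Context: For a real symmetric $N\times N$ matrix $X$, $\lambda_1(X)\le\dots\le\lambda_N(X)$ denote its eigenvalues in nondecreasing order and $\mathcal{P}^-_k(X)=\sum_{i=1}^k\lambda_i(X)$. $B_r^m$ and $\overline B_r^m$ denote the open and closed balls of radius $r$ centered at the origin in $\mathbb{R}^m$. $\mathrm{LSC}(\overline\Omega)$ is the set of lower semicontinuous functions $\overline\Omega\to\mathbb{R}$. Such a $u$ is a (viscosity) supersolution of $F(D^2u)=f$ in $\Omega$ if, whenever $\phi\in C^2(\Omega)$ and $u-\phi$ has a local minimum at $\hat x\in\Omega$, one has $F(D^2\phi(\hat x))\le f(\hat x)$.
   Formalization: In condition (ii), Γ is additionally assumed to be bounded (automatic for bounded Ω); without this (ii) is false, e.g. Ω=ℝ^N, f=0, u=0, or N=2, k=1, Ω={|x|>1}, u=(max(0,2−|x|))³. *)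

theory Defs
  imports "HOL-Analysis.Analysis" "HOL-Computational_Algebra.Computational_Algebra"
begin

definition charpoly :: "real^'n^'n \<Rightarrow> real poly" where
  "charpoly A = det (\<chi> i j. (if i = j then [:0, 1:] else 0) - [:A $ i $ j:])"

(* The roots of the characteristic polynomial, with multiplicity, in nondecreasing order.
   For symmetric A the list has length CARD('n); other matrices are never of interest. *)
definition eigenvalues :: "real^'n^'n \<Rightarrow> real list" where
  "eigenvalues A = sorted_list_of_multiset (proots (charpoly A))"

(* Indices start at 1: lam 1 A is the smallest eigenvalue, lam CARD('n) A the largest. *)
definition lam :: "nat \<Rightarrow> real^'n^'n \<Rightarrow> real" where
  "lam k A = eigenvalues A ! (k - 1)"

definition Pminus :: "nat \<Rightarrow> real^'n^'n \<Rightarrow> real" where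
  "Pminus k A = (\<Sum>i=1..k. lam i A)"

definition grad :: "(real^'n \<Rightarrow> real) \<Rightarrow> real^'n \<Rightarrow> real^'n" where
  "grad \<phi> x = (\<chi> i. frechet_derivative \<phi> (at x) (axis i 1))"

definition hessian :: "(real^'n \<Rightarrow> real) \<Rightarrow> real^'n \<Rightarrow> real^'n^'n" where
  "hessian \<phi> x = matrix (frechet_derivative (grad \<phi>) (at x))"

(* Intended for open S. *)
definition C2_on :: "(real^'n) set \<Rightarrow> (real^'n \<Rightarrow> real) \<Rightarrow> bool" where
  "C2_on S \<phi> \<longleftrightarrow>
     (\<forall>x\<in>S. \<phi> differentiable (at x) \<and> grad \<phi> differentiable (at x)) \<and>
     continuous_on S (hessian \<phi>)"

definition lsc_on :: "'a::topological_space set \<Rightarrow> ('a \<Rightarrow> real) \<Rightarrow> bool" where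
  "lsc_on S u \<longleftrightarrow> (\<forall>x\<in>S. \<forall>a<u x. \<forall>\<^sub>F y in at x within S. a < u y)"

definition local_min_at :: "'a::topological_space set \<Rightarrow> ('a \<Rightarrow> real) \<Rightarrow> 'a \<Rightarrow> bool" where
  "local_min_at S g x \<longleftrightarrow> (\<forall>\<^sub>F y in at x within S. g x \<le> g y)"

definition viscosity_supersolution ::
  "(real^'n^'n \<Rightarrow> real) \<Rightarrow> (real^'n \<Rightarrow> real) \<Rightarrow> (real^'n) set \<Rightarrow> (real^'n \<Rightarrow> real) \<Rightarrow> bool" where
  "viscosity_supersolution F f \<Omega> u \<longleftrightarrow>
     (\<forall>\<phi>. C2_on \<Omega> \<phi> \<longrightarrow>
        (\<forall>x\<in>\<Omega>. local_min_at \<Omega> (\<lambda>y. u y - \<phi> y) x \<longrightarrow> F (hessian \<phi> x) \<le> f x))"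

(* The points of \<Omega> at distance greater than \<delta> from the boundary. The distance to an empty
   boundary is infinite, whereas infdist x {} = 0, so that case is listed separately. *)
definition inner_part :: "(real^'n) set \<Rightarrow> real \<Rightarrow> (real^'n) set" where
  "inner_part \<Omega> \<delta> = {x\<in>\<Omega>. frontier \<Omega> = {} \<or> infdist x (frontier \<Omega>) > \<delta>}"

(* The splitting R^N = R^h x R^(N-h), with respect to a fixed enumeration 0, ..., N-1 of the
   coordinates: head_part h y and tail_part h y are the first h and the last N-h coordinates
   of y, each padded by zeros. *)
definition head_part :: "nat \<Rightarrow> real^'n \<Rightarrow> real^'n" where
  "head_part h y = (\<chi> i. if to_nat_on (UNIV :: 'n set) i < h then y $ i else 0)"

definition tail_part :: "nat \<Rightarrow> real^'n \<Rightarrow> real^'n" where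
  "tail_part h y = (\<chi> i. if to_nat_on (UNIV :: 'n set) i < h then 0 else y $ i)"

(* closed ball in R^h of radius r1 times closed ball in R^(N-h) of radius r2 *)
definition cylinder :: "nat \<Rightarrow> real \<Rightarrow> real \<Rightarrow> (real^'n) set" where
  "cylinder h r1 r2 = {y. norm (head_part h y) \<le> r1 \<and> norm (tail_part h y) \<le> r2}"

(* closed ball in R^h of radius r1 times sphere in R^(N-h) of radius r2 *)
definition lateral :: "nat \<Rightarrow> real \<Rightarrow> real \<Rightarrow> (real^'n) set" where
  "lateral h r1 r2 = {y. norm (head_part h y) \<le> r1 \<and> norm (tail_part h y) = r2}"

end

theory Submission
  imports Defs
begin

text \<open>Constant test functions show that every minimum point \<open>x\<close> of \<open>u\<close> lies in \<open>\<Gamma>\<close>. Take a compact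
  neighbourhood \<open>K \<subseteq> \<Omega>\<close> of \<open>x\<close> and the test function \<open>\<phi>(y) = t (y - x) \<bullet> A (y - x) / 2\<close> with \<open>t > 0\<close>
  small and \<open>F(tA) > 0\<close>. If \<open>\<phi> < u - u(x)\<close> on the boundary of \<open>K\<close>, then \<open>u - \<phi>\<close> has a local
  minimum inside \<open>K\<close>, where \<open>F(tA) \<le> f \<le> 0\<close>, a contradiction. In cases (i) and (ii) some \<open>K\<close> has
  boundary disjoint from \<open>\<Gamma>\<close>, and \<open>A\<close> is the identity. In cases (iii) and (iv) \<open>K\<close> is the cylinder,
  and \<open>A\<close> has the eigenvalue \<open>-1/r1\<^sup>2\<close> on the \<open>h\<close> axial directions and \<open>1/r2\<^sup>2\<close> on the others: off
  the lateral boundary, where \<open>u\<close> may attain its minimum, the form is negative.\<close>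

lemma lsc_attains_inf:
  fixes u :: "'a::metric_space \<Rightarrow> real"
  assumes K: "compact K" "K \<noteq> {}" and lsc: "lsc_on K u"
  obtains x where "x \<in> K" "\<And>y. y \<in> K \<Longrightarrow> u x \<le> u y"
proof -
  have "\<exists>x\<in>K. \<forall>y\<in>K. u x \<le> u y"
  proof (rule ccontr)
    assume "\<not> ?thesis"
    then have no_min: "\<And>x. x \<in> K \<Longrightarrow> \<exists>y\<in>K. u y < u x"
      by (auto simp: not_le)
    define U where "U y = {x\<in>K. u y < u x}" for y
    have "openin (top_of_set K) (U y)" for y
      unfolding openin_euclidean_subtopology_iff
    proof (intro conjI ballI)
      fix x assume x: "x \<in> U y"
      then have "\<forall>\<^sub>F z in at x within K. u y < u z"
        using lsc by (auto simp: lsc_on_def U_def)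
      then obtain e where "e > 0" "\<And>z. z \<in> K \<Longrightarrow> z \<noteq> x \<Longrightarrow> dist z x < e \<Longrightarrow> u y < u z"
        by (auto simp: eventually_at)
      with x show "\<exists>e>0. \<forall>z\<in>K. dist z x < e \<longrightarrow> z \<in> U y"
        unfolding U_def by (metis (mono_tags, lifting) mem_Collect_eq)
    qed (auto simp: U_def)
    moreover have "K \<subseteq> \<Union>(U ` K)"
      using no_min by (auto simp: U_def)
    ultimately obtain D where D: "D \<subseteq> U ` K" "finite D" "K \<subseteq> \<Union>D"
      using \<open>compact K\<close> compact_eq_openin_cover[of K] by (metis (no_types, lifting) imageE)
    then obtain C where C: "C \<subseteq> K" "finite C" "D = U ` C"
      by (meson finite_subset_image)
    have "C \<noteq> {}"
      using C D K by auto
    then obtain c where c: "c \<in> C" "\<And>y. y \<in> C \<Longrightarrow> u c \<le> u y"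
      using C(2) by (metis arg_min_if_finite(1) arg_min_least)
    then obtain y where "y \<in> C" "c \<in> U y"
      using C D by blast
    with c show False
      by (force simp: U_def)
  qed
  then show ?thesis
    using that by blast
qed

lemma lsc_on_subset: "lsc_on S u \<Longrightarrow> T \<subseteq> S \<Longrightarrow> lsc_on T u"
  unfolding lsc_on_def by (meson at_le filter_leD subsetD)

lemma lsc_on_diff_continuous:
  fixes u \<phi> :: "'a::topological_space \<Rightarrow> real"
  assumes u: "lsc_on S u" and \<phi>: "continuous_on S \<phi>"
  shows "lsc_on S (\<lambda>x. u x - \<phi> x)"
  unfolding lsc_on_def
proof (intro ballI allI impI)
  fix x a assume x: "x \<in> S" and a: "a < u x - \<phi> x"
  define e where "e = (u x - \<phi> x - a) / 2"
  have e: "e > 0"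
    using a by (simp add: e_def)
  have "\<forall>\<^sub>F y in at x within S. u x - e < u y"
    using u x e by (auto simp: lsc_on_def)
  moreover have "\<forall>\<^sub>F y in at x within S. \<phi> y < \<phi> x + e"
    using \<phi> x e by (intro order_tendstoD(2)[of _ "\<phi> x"]) (auto simp: continuous_on_def)
  ultimately show "\<forall>\<^sub>F y in at x within S. a < u y - \<phi> y"
    by eventually_elim (simp add: e_def field_simps)
qed

lemma charpoly_mat_diff:
  "charpoly A = det (mat [:0, 1:] - (\<chi> i j. [:A $ i $ j:]))"
  unfolding charpoly_def mat_def by (rule arg_cong[where f = det]) (simp add: vec_eq_iff)

lemma const_poly_matrix_mult:
  fixes A B :: "real^'n^'n"
  shows "(\<chi> i j. [:(A ** B) $ i $ j:]) = (\<chi> i j. [:A $ i $ j:]) ** (\<chi> i j. [:B $ i $ j:])"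
  by (simp add: vec_eq_iff matrix_matrix_mult_def sum_to_poly mult.commute)

lemma matrix_diff_ldistrib: "A ** (B - C) = A ** B - A ** C"
  for A :: "'a::ring_1^'n^'m"
  by (vector matrix_matrix_mult_def sum_subtractf[symmetric] right_diff_distrib)

lemma matrix_diff_rdistrib: "(A - B) ** C = A ** C - B ** C"
  for A :: "'a::ring_1^'n^'m"
  by (vector matrix_matrix_mult_def sum_subtractf[symmetric] left_diff_distrib)

lemma charpoly_similar:
  fixes A P R :: "real^'n^'n"
  assumes PR: "P ** R = mat 1"
  shows "charpoly (P ** A ** R) = charpoly A"
proof -
  let ?c = "\<lambda>M :: real^'n^'n. (\<chi> i j. [:M $ i $ j:])"
  let ?X = "mat [:0, 1:] :: real poly^'n^'n"
  have PR': "?c P ** ?c R = mat 1"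
    unfolding const_poly_matrix_mult[symmetric] PR by (simp add: vec_eq_iff mat_def)
  have X: "?c P ** ?X = ?X ** ?c P"
    by (simp add: vec_eq_iff mat_def matrix_matrix_mult_def if_distrib if_distribR cong: if_cong)
  have "?X - ?c (P ** A ** R) = ?X ** (?c P ** ?c R) - ?c P ** ?c A ** ?c R"
    by (simp only: PR' const_poly_matrix_mult matrix_mul_rid)
  also have "\<dots> = ?c P ** (?X - ?c A) ** ?c R"
    by (simp only: matrix_diff_ldistrib matrix_diff_rdistrib X matrix_mul_assoc)
  finally have "charpoly (P ** A ** R) = det (?c P ** (?X - ?c A) ** ?c R)"
    by (simp only: charpoly_mat_diff)
  then have "charpoly (P ** A ** R) = det (?c P ** ?c R) * charpoly A"
    by (simp add: charpoly_mat_diff det_mul mult_ac)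
  then show ?thesis
    by (simp add: PR')
qed

lemma eigenvalues_diagonal:
  fixes d :: "'n::finite \<Rightarrow> real"
  shows "eigenvalues (\<chi> i j. if i = j then d i else 0) =
    sorted_list_of_multiset (image_mset d (mset_set UNIV))"
proof -
  have "charpoly (\<chi> i j. if i = j then d i else 0) = (\<Prod>i\<in>UNIV. [:- d i, 1:])"
    unfolding charpoly_def by (subst det_diagonal) auto
  also have "proots \<dots> = (\<Sum>i\<in>UNIV. {#d i#})"
    by (subst proots_prod) auto
  also have "\<dots> = image_mset d (mset_set UNIV)"
    by (simp add: sum_unfold_sum_mset)
  finally show ?thesis
    by (simp add: eigenvalues_def)
qed

definition axis_form :: "nat \<Rightarrow> real \<Rightarrow> real \<Rightarrow> real^'n^'n \<Rightarrow> real^'n^'n" where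
  "axis_form h a b Q =
     Q ** (\<chi> i j. if i = j then if to_nat_on (UNIV :: 'n set) i < h then - a else b else 0) ** transpose Q"

lemma scaleR_axis_form: "t *\<^sub>R axis_form h a b Q = axis_form h (t * a) (t * b) Q"
  unfolding axis_form_def scalar_matrix_assoc matrix_scalar_ac[symmetric]
  by (intro arg_cong[where f = "\<lambda>M. Q ** M ** transpose Q"]) (simp add: vec_eq_iff)

lemma transpose_axis_form: "transpose (axis_form h a b Q) = axis_form h a b Q"
  for Q :: "real^'n^'n"
proof -
  have "transpose (\<chi> i j. if i = j then d i else 0) = (\<chi> i j. if i = j then d i else (0::real))"
    for d :: "'n \<Rightarrow> real"
    by (simp add: vec_eq_iff transpose_def)
  then show ?thesis
    by (simp add: axis_form_def matrix_transpose_mul matrix_mul_assoc)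
qed

lemma axis_form_quadratic:
  fixes Q :: "real^'n^'n"
  assumes "orthogonal_matrix Q"
  shows "(Q *v z) \<bullet> (axis_form h a b Q *v (Q *v z)) =
    b * (norm (tail_part h z))\<^sup>2 - a * (norm (head_part h z))\<^sup>2"
proof -
  let ?D = "(\<chi> i j. if i = j then if to_nat_on (UNIV :: 'n set) i < h then - a else b else 0)"
  have QQ: "transpose Q ** Q = mat 1"
    using assms by (simp add: orthogonal_matrix_def)
  have D: "(?D *v z) $ i = (if to_nat_on (UNIV :: 'n set) i < h then - a else b) * z $ i" for i
    by (simp add: matrix_vector_mult_def if_distrib[where f = "\<lambda>c. c * _"] cong: if_cong)
  have inner: "(Q *v v) \<bullet> (Q *v w) = v \<bullet> w" for v w
    by (metis QQ dot_lmul_matrix matrix_vector_mul_assoc matrix_vector_mul_lid vector_transpose_matrix)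
  have "axis_form h a b Q *v (Q *v z) = Q *v (?D *v ((transpose Q ** Q) *v z))"
    by (simp add: axis_form_def matrix_vector_mul_assoc matrix_mul_assoc)
  then have "(Q *v z) \<bullet> (axis_form h a b Q *v (Q *v z)) = z \<bullet> (?D *v z)"
    using inner by (simp add: QQ)
  also have "\<dots> = (\<Sum>i\<in>UNIV. b * (tail_part h z $ i)\<^sup>2 - a * (head_part h z $ i)\<^sup>2)"
    unfolding inner_vec_def
    by (intro sum.cong) (auto simp: D head_part_def tail_part_def power2_eq_square)
  also have "\<dots> = b * (norm (tail_part h z))\<^sup>2 - a * (norm (head_part h z))\<^sup>2"
    unfolding power2_norm_eq_inner inner_vec_def
    by (simp add: sum_subtractf sum_distrib_left power2_eq_square)
  finally show ?thesis .
qed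

lemma eigenvalues_axis_form:
  fixes Q :: "real^'n^'n"
  assumes "orthogonal_matrix Q" and h: "h \<le> CARD('n)" and "- a \<le> b"
  shows "eigenvalues (axis_form h a b Q) = replicate h (- a) @ replicate (CARD('n) - h) b"
proof -
  let ?H = "{i :: 'n. to_nat_on (UNIV :: 'n set) i < h}"
  let ?d = "\<lambda>i. if to_nat_on (UNIV :: 'n set) i < h then - a else b"
  have bij: "bij_betw (to_nat_on (UNIV :: 'n set)) UNIV {..<CARD('n)}"
    by (rule to_nat_on_finite) simp
  have "to_nat_on (UNIV :: 'n set) ` ?H = {..<h}"
  proof
    show "{..<h} \<subseteq> to_nat_on (UNIV :: 'n set) ` ?H"
    proof
      fix m assume m: "m \<in> {..<h}"
      then have "m \<in> to_nat_on (UNIV :: 'n set) ` UNIV"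
        using bij h by (simp add: bij_betw_def)
      with m show "m \<in> to_nat_on (UNIV :: 'n set) ` ?H"
        by auto
    qed
  qed auto
  then have "card ?H = h"
    using bij by (metis bij_betw_def card_image card_lessThan inj_on_subset subset_UNIV)
  moreover have "card (- ?H) = CARD('n) - card ?H"
    by (simp add: Compl_eq_Diff_UNIV card_Diff_subset)
  moreover have "image_mset ?d (mset_set UNIV) =
      image_mset ?d (mset_set ?H) + image_mset ?d (mset_set (- ?H))"
    by (subst image_mset_union[symmetric], subst mset_set_Union[symmetric]) auto
  moreover have "image_mset ?d (mset_set ?H) = image_mset (\<lambda>_. - a) (mset_set ?H)"
    by (rule image_mset_cong) auto
  moreover have "image_mset ?d (mset_set (- ?H)) = image_mset (\<lambda>_. b) (mset_set (- ?H))"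
    by (rule image_mset_cong) auto
  ultimately have "image_mset ?d (mset_set UNIV) = mset (replicate h (- a) @ replicate (CARD('n) - h) b)"
    by (simp add: image_mset_const_eq)
  moreover have "sorted (replicate h (- a) @ replicate (CARD('n) - h) b)"
    using assms by (simp add: sorted_append)
  moreover have "eigenvalues (axis_form h a b Q) = sorted_list_of_multiset (image_mset ?d (mset_set UNIV))"
    unfolding axis_form_def eigenvalues_diagonal[symmetric] eigenvalues_def
    using assms by (subst charpoly_similar) (auto simp: orthogonal_matrix_def)
  ultimately show ?thesis
    by (simp only: sorted_list_of_multiset_mset sorted_sort_id)
qed

lemma lam_axis_form:
  fixes Q :: "real^'n^'n"
  assumes "orthogonal_matrix Q" "h \<le> CARD('n)" "- a \<le> b" "1 \<le> k" "k \<le> CARD('n)"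
  shows "lam k (axis_form h a b Q) = (if k \<le> h then - a else b)"
  using assms by (auto simp: lam_def eigenvalues_axis_form nth_append)

lemma Pminus_axis_form:
  fixes Q :: "real^'n^'n"
  assumes "orthogonal_matrix Q" "h \<le> k" "- a \<le> b" "k \<le> CARD('n)"
  shows "Pminus k (axis_form h a b Q) = real (k - h) * b - real h * a"
proof -
  have "Pminus k (axis_form h a b Q) = (\<Sum>i=1..k. if i \<le> h then - a else b)"
    unfolding Pminus_def using assms by (intro sum.cong) (auto simp: lam_axis_form)
  moreover have "{1..k} \<inter> {i. i \<le> h} = {1..h}" "{1..k} \<inter> - {i. i \<le> h} = {h<..k}"
    using assms by auto
  then have "(\<Sum>i=1..k. if i \<le> h then - a else b) = real (k - h) * b - real h * a"
    by (subst sum.If_cases) simp_all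
  ultimately show ?thesis
    by simp
qed

lemma continuous_on_matrix_vector_mult:
  fixes A :: "real^'n^'m"
  assumes "continuous_on S g"
  shows "continuous_on S (\<lambda>x. A *v g x)"
  using continuous_on_compose2[OF matrix_vector_mult_linear_continuous_on assms subset_UNIV] .

lemma quadratic_test_function:
  fixes A :: "real^'n^'n" and x :: "real^'n"
  assumes A: "transpose A = A"
  defines "\<phi> \<equiv> \<lambda>y. (y - x) \<bullet> (A *v (y - x)) / 2"
  shows "hessian \<phi> y = A" and "C2_on S \<phi>"
proof -
  have deriv: "(\<phi> has_derivative (\<lambda>v. v \<bullet> (A *v (y - x)))) (at y)" for y
  proof -
    have "(\<phi> has_derivative (\<lambda>v. ((y - x) \<bullet> (A *v v) + v \<bullet> (A *v (y - x))) / 2)) (at y)"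
      unfolding \<phi>_def
      by (auto intro!: derivative_eq_intros
          bounded_linear.has_derivative[OF matrix_vector_mul_bounded_linear])
    moreover have "(y - x) \<bullet> (A *v v) = v \<bullet> (A *v (y - x))" for v
      by (metis A dot_lmul_matrix inner_commute vector_transpose_matrix)
    ultimately show ?thesis
      by simp
  qed
  have "frechet_derivative \<phi> (at y) = (\<lambda>v. v \<bullet> (A *v (y - x)))" for y
    using frechet_derivative_at[OF deriv] by simp
  then have grad: "grad \<phi> = (\<lambda>y. A *v (y - x))"
    by (simp add: grad_def fun_eq_iff vec_eq_iff inner_axis')
  have grad_deriv: "(grad \<phi> has_derivative (*v) A) (at y)" for y
    unfolding grad
    by (auto intro!: derivative_eq_intros
        bounded_linear.has_derivative[OF matrix_vector_mul_bounded_linear])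
  show hess: "hessian \<phi> y = A" for y
    unfolding hessian_def frechet_derivative_at[OF grad_deriv, symmetric] by simp
  show "C2_on S \<phi>"
    unfolding C2_on_def hess using deriv grad_deriv by (auto simp: differentiable_def)
qed

lemma viscosity_supersolution_quadratic:
  fixes A :: "real^'n^'n"
  assumes visc: "viscosity_supersolution F f \<Omega> u"
    and A: "transpose A = A"
    and y: "y \<in> \<Omega>"
    and min: "local_min_at \<Omega> (\<lambda>z. u z - (z - x) \<bullet> (A *v (z - x)) / 2) y"
  shows "F A \<le> f y"
  using visc[unfolded viscosity_supersolution_def, rule_format,
      OF quadratic_test_function(2)[OF A] y min]
  unfolding quadratic_test_function(1)[OF A] .

text \<open>The boundary condition allows \<open>f < 0\<close>, which keeps \<open>u\<close> away from its minimum there,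
  or a negative value of the quadratic form, which pushes the test function below the minimum.\<close>

lemma supersolution_no_min_in_compact:
  fixes A :: "real^'n^'n"
  assumes f: "\<And>y. y \<in> \<Omega> \<Longrightarrow> f y \<le> 0"
    and visc: "viscosity_supersolution F f \<Omega> u"
    and lsc: "lsc_on \<Omega> u"
    and min: "\<And>y. y \<in> \<Omega> \<Longrightarrow> u x \<le> u y"
    and F0: "F 0 = 0"
    and A: "transpose A = A"
    and FA: "\<And>t. t > 0 \<Longrightarrow> F (t *\<^sub>R A) > 0"
    and K: "compact K" "K \<subseteq> \<Omega>" "x \<in> K"
    and bdry: "\<And>y. y \<in> K \<Longrightarrow> y \<notin> interior K \<Longrightarrow> f y < 0 \<or> (y - x) \<bullet> (A *v (y - x)) < 0"
  shows False
proof -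
  define q where "q y = (y - x) \<bullet> (A *v (y - x))" for y
  have q_cont: "continuous_on S q" for S
    unfolding q_def by (intro continuous_intros continuous_on_matrix_vector_mult)
  have above: "u x < u y" if y: "y \<in> \<Omega>" "f y < 0" for y
  proof (rule ccontr)
    assume "\<not> u x < u y"
    then have "\<And>z. z \<in> \<Omega> \<Longrightarrow> u y \<le> u z"
      using min by fastforce
    then have "local_min_at \<Omega> (\<lambda>z. u z - ((z - x) \<bullet> (0 *v (z - x)) / 2)) y"
      by (auto simp: local_min_at_def eventually_at_filter)
    moreover have "transpose (0 :: real^'n^'n) = 0"
      by (simp add: transpose_def vec_eq_iff)
    ultimately have "F 0 \<le> f y"
      by (intro viscosity_supersolution_quadratic[OF visc _ y(1)])
    with y F0 show False
      by simp
  qed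
  define B where "B = {y\<in>K - interior K. 0 \<le> q y}"
  have "B = K \<inter> (- interior K \<inter> {y. 0 \<le> q y})"
    by (auto simp: B_def)
  then have B: "compact B"
    using K(1) by (auto intro!: compact_Int_closed closed_Int closed_Collect_le continuous_intros q_cont)
  have uB: "u x < u y" if "y \<in> B" for y
    using that bdry[of y] above[of y] K(2) by (auto simp: B_def q_def)
  obtain t where t: "t > 0" "\<And>y. y \<in> B \<Longrightarrow> u x < u y - t * q y / 2"
  proof (cases "B = {}")
    case True
    then show ?thesis
      using that[of 1] by simp
  next
    case False
    obtain z where z: "z \<in> B" "\<And>y. y \<in> B \<Longrightarrow> u z \<le> u y"
      using lsc_attains_inf[OF B False] lsc_on_subset[OF lsc, of B] K(2) B_def by blast
    obtain w where w: "w \<in> B" "\<And>y. y \<in> B \<Longrightarrow> q y \<le> q w"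
      using continuous_attains_sup[OF B False q_cont] by blast
    define t where "t = (u z - u x) / (q w + 1)"
    have qw: "q w \<ge> 0"
      using w by (simp add: B_def)
    have pos: "u z - u x > 0"
      using uB z by simp
    then have t: "t > 0"
      using qw by (simp add: t_def)
    show ?thesis
    proof (rule that[OF t])
      fix y assume y: "y \<in> B"
      have "t * q y \<le> t * q w"
        using t w(2)[OF y] by simp
      also have "\<dots> < t * (q w + 1)"
        using t by simp
      also have "\<dots> = u z - u x"
        using qw by (simp add: t_def)
      finally show "u x < u y - t * q y / 2"
        using z(2)[OF y] pos by linarith
    qed
  qed
  have bdry_above: "u x < u y - t * q y / 2" if "y \<in> K" "y \<notin> interior K" for y
  proof (cases "0 \<le> q y")
    case True
    then show ?thesis
      using that t by (simp add: B_def)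
  next
    case False
    then have "t * q y < 0"
      using t by (simp add: mult_pos_neg)
    then show ?thesis
      using min[of y] K that by force
  qed
  have "lsc_on K (\<lambda>y. u y - t * q y / 2)"
    using lsc_on_subset[OF lsc K(2)] by (intro lsc_on_diff_continuous continuous_intros q_cont) auto
  then obtain z where z: "z \<in> K" "\<And>y. y \<in> K \<Longrightarrow> u z - t * q z / 2 \<le> u y - t * q y / 2"
    using lsc_attains_inf[OF K(1)] K(3) by blast
  have "u z - t * q z / 2 \<le> u x"
    using z(2)[OF K(3)] by (simp add: q_def)
  then have "z \<in> interior K"
    using bdry_above[OF z(1)] by force
  then have "\<forall>\<^sub>F y in at z within \<Omega>. y \<in> K"
    using interior_subset by (auto simp: eventually_at_topological intro!: exI[of _ "interior K"])
  then have "\<forall>\<^sub>F y in at z within \<Omega>. u z - t * q z / 2 \<le> u y - t * q y / 2"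
    by eventually_elim (rule z(2))
  then have "local_min_at \<Omega> (\<lambda>y. u y - ((y - x) \<bullet> ((t *\<^sub>R A) *v (y - x)) / 2)) z"
    by (simp add: local_min_at_def q_def scaleR_matrix_vector_assoc[symmetric])
  moreover have "transpose (t *\<^sub>R A) = t *\<^sub>R A"
    using A by (simp add: transpose_scalar)
  ultimately have "F (t *\<^sub>R A) \<le> f z"
    using z(1) K(2) by (intro viscosity_supersolution_quadratic[OF visc]) auto
  then show False
    using FA[OF t(1)] f[of z] z(1) K(2) by force
qed

lemma head_tail_norm: "(norm y)\<^sup>2 = (norm (head_part h y))\<^sup>2 + (norm (tail_part h y))\<^sup>2"
  by (simp add: power2_norm_eq_inner inner_vec_def head_part_def tail_part_def
      sum.distrib[symmetric]) (intro sum.cong, auto)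

lemma linear_head_part: "linear (head_part h)" and linear_tail_part: "linear (tail_part h)"
  by (auto intro!: linearI simp: head_part_def tail_part_def vec_eq_iff)

lemma continuous_on_head_part: "continuous_on S (head_part h)"
  and continuous_on_tail_part: "continuous_on S (tail_part h)"
  by (simp_all add: linear_continuous_on linear_conv_bounded_linear[symmetric]
      linear_head_part linear_tail_part)

lemma compact_cylinder: "compact (cylinder h r1 r2 :: (real^'n) set)"
proof -
  have "norm y \<le> sqrt (r1\<^sup>2 + r2\<^sup>2)" if "y \<in> cylinder h r1 r2" for y :: "real^'n"
  proof (rule real_le_rsqrt)
    show "(norm y)\<^sup>2 \<le> r1\<^sup>2 + r2\<^sup>2"
      using that unfolding head_tail_norm[of y h] cylinder_def
      by (intro add_mono power_mono) auto
  qed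
  then have "bounded (cylinder h r1 r2 :: (real^'n) set)"
    by (auto simp: bounded_iff)
  moreover have "closed (cylinder h r1 r2 :: (real^'n) set)"
    unfolding cylinder_def
    by (intro closed_Collect_conj closed_Collect_le continuous_on_norm continuous_on_const
        continuous_on_head_part continuous_on_tail_part)
  ultimately show ?thesis
    by (simp add: compact_eq_bounded_closed)
qed

lemma open_open_cylinder:
  "open {y :: real^'n. norm (head_part h y) < r1 \<and> norm (tail_part h y) < r2}"
  by (intro open_Collect_conj open_Collect_less continuous_on_norm continuous_on_const
        continuous_on_head_part continuous_on_tail_part)

theorem theorem15:
  fixes \<Omega> \<Gamma> :: "(real^'n) set"
    and f u :: "real^'n \<Rightarrow> real"
    and F :: "real^'n^'n \<Rightarrow> real"
    and k :: nat
  assumes "open \<Omega>"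
    and "continuous_on \<Omega> f"
    and "\<forall>x\<in>\<Omega>. f x \<le> 0"
    and "\<Gamma> = {x\<in>\<Omega>. f x = 0}"
    and "1 \<le> k" and "k < CARD('n)"
    and "F = lam k \<or> F = Pminus k"
    and "lsc_on (closure \<Omega>) u"
    and "viscosity_supersolution F f \<Omega> u"
    and "\<forall>x\<in>\<Omega>. u x \<ge> 0"
    and "discrete \<Gamma> \<or>
         (bounded \<Gamma> \<and> (\<exists>\<delta>>0. \<Gamma> \<subseteq> inner_part \<Omega> \<delta>)) \<or>
         (F = lam k \<and>
           (\<forall>x\<in>\<Gamma>. \<exists>r1>0. \<exists>r2>0. \<exists>h\<in>{1..k-1}. \<exists>Q::real^'n^'n. orthogonal_matrix Q \<and>
              (\<lambda>y. x + Q *v y) ` lateral h r1 r2 \<inter> \<Gamma> = {} \<and>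
              (\<lambda>y. x + Q *v y) ` cylinder h r1 r2 \<subseteq> \<Omega>)) \<or>
         (F = Pminus k \<and>
           (\<forall>x\<in>\<Gamma>. \<exists>r1>0. \<exists>r2>0. \<exists>h\<in>{1..k-1}. \<exists>Q::real^'n^'n. orthogonal_matrix Q \<and>
              (r2 / r1)\<^sup>2 < real k / real h - 1 \<and>
              (\<lambda>y. x + Q *v y) ` lateral h r1 r2 \<inter> \<Gamma> = {} \<and>
              (\<lambda>y. x + Q *v y) ` cylinder h r1 r2 \<subseteq> \<Omega>))"
  shows "\<not> (\<exists>x\<in>\<Omega>. \<forall>y\<in>\<Omega>. u x \<le> u y)"
proof
  assume "\<exists>x\<in>\<Omega>. \<forall>y\<in>\<Omega>. u x \<le> u y"
  then obtain x where x: "x \<in> \<Omega>" and min: "\<And>y. y \<in> \<Omega> \<Longrightarrow> u x \<le> u y"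
    by blast
  note \<Gamma> = assms(4)
  have f_neg: "f y < 0" if "y \<in> \<Omega>" "y \<notin> \<Gamma>" for y
    using that assms(3) \<Gamma> by force
  have lsc: "lsc_on \<Omega> u"
    using lsc_on_subset[OF assms(8) closure_subset] .
  have "axis_form 0 0 0 (mat 1) = (0 :: real^'n^'n)"
    using scaleR_axis_form[of 0 0 0 0 "mat 1 :: real^'n^'n"] by simp
  moreover have "lam k (axis_form 0 0 0 (mat 1) :: real^'n^'n) = 0"
    and "Pminus k (axis_form 0 0 0 (mat 1) :: real^'n^'n) = 0"
    using assms(5,6)
    by (auto simp: lam_axis_form Pminus_axis_form orthogonal_matrix_id)
  ultimately have F0: "F 0 = 0"
    using assms(7) by auto
  have no_min: False
    if "orthogonal_matrix Q" "\<And>t. t > 0 \<Longrightarrow> F (axis_form h (t * a) (t * b) Q) > 0"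
      "compact K" "K \<subseteq> \<Omega>" "x \<in> K"
      "\<And>y. y \<in> K \<Longrightarrow> y \<notin> interior K \<Longrightarrow> y \<notin> \<Gamma> \<or> (y - x) \<bullet> (axis_form h a b Q *v (y - x)) < 0"
    for h a b Q K
  proof (rule supersolution_no_min_in_compact[where A = "axis_form h a b Q" and K = K and x = x
        and F = F and f = f and u = u and \<Omega> = \<Omega>])
    fix y assume "y \<in> K" "y \<notin> interior K"
    then show "f y < 0 \<or> (y - x) \<bullet> (axis_form h a b Q *v (y - x)) < 0"
      using that(4,6) f_neg by blast
  qed (use that assms(3,9) lsc min F0 in \<open>auto simp: transpose_axis_form scaleR_axis_form\<close>)
  have F_id: "F (axis_form 0 (t * 0) (t * 1) (mat 1)) > 0" if "t > 0" for t
    using assms(5-7) that by (auto simp: lam_axis_form Pminus_axis_form orthogonal_matrix_id)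
  note no_min_id = no_min[OF orthogonal_matrix_id, of 0 0 1, OF F_id]
  have x\<Gamma>: "x \<in> \<Gamma>"
  proof (rule ccontr)
    assume "x \<notin> \<Gamma>"
    then show False
      using no_min_id[of "{x}"] x by simp
  qed
  have no_min_cylinder: False
    if Q: "orthogonal_matrix Q" and r: "r1 > 0" "r2 > 0"
      and pos: "\<And>t. t > 0 \<Longrightarrow> F (axis_form h (t * (1 / r1\<^sup>2)) (t * (1 / r2\<^sup>2)) Q) > 0"
      and lat: "(\<lambda>y. x + Q *v y) ` lateral h r1 r2 \<inter> \<Gamma> = {}"
      and sub: "(\<lambda>y. x + Q *v y) ` cylinder h r1 r2 \<subseteq> \<Omega>" for r1 r2 h Q
  proof (rule no_min[OF Q pos _ sub])
    let ?g = "\<lambda>y. x + Q *v y"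
    show "compact (?g ` cylinder h r1 r2)"
      by (intro compact_continuous_image compact_cylinder continuous_intros
          continuous_on_matrix_vector_mult)
    have "head_part h (0 :: real^'n) = 0" "tail_part h (0 :: real^'n) = 0"
      by (simp_all add: head_part_def tail_part_def vec_eq_iff)
    then have "?g 0 \<in> ?g ` cylinder h r1 r2"
      using r by (intro imageI) (simp add: cylinder_def)
    then show "x \<in> ?g ` cylinder h r1 r2"
      by simp
    fix y assume "y \<in> ?g ` cylinder h r1 r2" and not_int: "y \<notin> interior (?g ` cylinder h r1 r2)"
    then obtain z where z: "z \<in> cylinder h r1 r2" "y = x + Q *v z"
      by blast
    let ?U = "{y :: real^'n. norm (head_part h y) < r1 \<and> norm (tail_part h y) < r2}"
    have QQ: "Q *v (transpose Q *v v) = v" "transpose Q *v (Q *v v) = v" for v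
      using Q by (simp_all add: matrix_vector_mul_assoc orthogonal_matrix_def
          del: vector_transpose_matrix transpose_matrix_vector)
    have "?g ` ?U = (\<lambda>y. transpose Q *v (y - x)) -` ?U"
      using QQ by (force simp: image_iff)
    then have "open (?g ` ?U)"
      by (simp only:) (intro open_vimage open_open_cylinder continuous_intros
          continuous_on_matrix_vector_mult)
    moreover have "?g ` ?U \<subseteq> ?g ` cylinder h r1 r2"
      by (intro image_mono) (auto simp: cylinder_def)
    ultimately have "z \<notin> ?U"
      using not_int z(2) interior_maximal by blast
    then consider "norm (tail_part h z) = r2" | "norm (head_part h z) = r1" "norm (tail_part h z) < r2"
      using z(1) by (force simp: cylinder_def)
    then show "y \<notin> \<Gamma> \<or> (y - x) \<bullet> (axis_form h (1 / r1\<^sup>2) (1 / r2\<^sup>2) Q *v (y - x)) < 0"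
    proof cases
      case 1
      then have "z \<in> lateral h r1 r2"
        using z(1) by (simp add: cylinder_def lateral_def)
      then show ?thesis
        using lat z(2) by blast
    next
      case 2
      then have "(norm (tail_part h z))\<^sup>2 < r2\<^sup>2"
        by (intro power_strict_mono) auto
      then have "(y - x) \<bullet> (axis_form h (1 / r1\<^sup>2) (1 / r2\<^sup>2) Q *v (y - x)) < 0"
        using 2 r z(2) by (simp add: axis_form_quadratic[OF Q])
      then show ?thesis ..
    qed
  qed
  from assms(11) show False
  proof (elim disjE conjE)
    assume "discrete \<Gamma>"
    then obtain T where T: "open T" "T \<inter> \<Gamma> = {x}"
      using x\<Gamma> by (auto simp: discrete_def isolated_in_def)
    then have "open (T \<inter> \<Omega>)" "x \<in> T \<inter> \<Omega>"
      using assms(1) x by auto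
    then obtain r where r: "r > 0" "cball x r \<subseteq> T \<inter> \<Omega>"
      unfolding open_contains_cball by blast
    show False
    proof (rule no_min_id)
      show "y \<notin> \<Gamma> \<or> (y - x) \<bullet> (axis_form 0 0 1 (mat 1) *v (y - x)) < 0"
        if "y \<in> cball x r" "y \<notin> interior (cball x r)" for y
      proof -
        have "y \<in> T" "y \<noteq> x"
          using that r by auto
        then show ?thesis
          using T(2) by blast
      qed
    qed (use r in auto)
  next
    assume "bounded \<Gamma>" "\<exists>\<delta>>0. \<Gamma> \<subseteq> inner_part \<Omega> \<delta>"
    then obtain \<delta> where \<delta>: "\<delta> > 0" "\<Gamma> \<subseteq> inner_part \<Omega> \<delta>"
      by blast
    have "closed \<Gamma>"
      unfolding closed_sequential_limits
    proof (intro allI impI, elim conjE)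
      fix s l assume s: "\<forall>n. s n \<in> \<Gamma>" and l: "s \<longlonglongrightarrow> l"
      have "l \<notin> frontier \<Omega>"
      proof
        assume l_bd: "l \<in> frontier \<Omega>"
        have "s n \<in> inner_part \<Omega> \<delta>" for n
          using s \<delta> by blast
        then have "\<delta> \<le> infdist (s n) (frontier \<Omega>)" for n
          using l_bd by (force simp: inner_part_def intro: less_imp_le)
        then have "\<delta> \<le> infdist l (frontier \<Omega>)"
          by (intro LIMSEQ_le_const[OF tendsto_infdist[OF l]]) auto
        with l_bd \<delta> show False
          by simp
      qed
      moreover have "l \<in> closure \<Omega>"
        using s l \<Gamma> by (auto simp: closure_sequential)
      ultimately have "l \<in> \<Omega>"
        using assms(1) by (simp add: frontier_def interior_open)
      moreover from this have "(\<lambda>n. f (s n)) \<longlonglongrightarrow> f l"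
        using assms(2) s l \<Gamma> by (intro continuous_on_tendsto_compose[OF assms(2) l]) auto
      then have "f l = 0"
        using s \<Gamma> by (simp add: LIMSEQ_const_iff)
      ultimately show "l \<in> \<Gamma>"
        using \<Gamma> by simp
    qed
    with \<open>bounded \<Gamma>\<close> have comp: "compact \<Gamma>"
      by (simp add: compact_eq_bounded_closed)
    obtain \<epsilon> where \<epsilon>: "\<epsilon> > 0" "(\<Union>y\<in>\<Gamma>. cball y \<epsilon>) \<subseteq> \<Omega>"
      using compact_subset_open_imp_cball_epsilon_subset[OF comp assms(1)] \<Gamma> by blast
    have ne: "\<Gamma> \<noteq> {}"
      using x\<Gamma> by blast
    let ?K = "{y. infdist y \<Gamma> \<le> \<epsilon>}"
    show False
    proof (rule no_min_id)
      show "compact ?K"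
        using compact_infdist_le[OF ne comp \<epsilon>(1)] .
      show "?K \<subseteq> \<Omega>"
      proof
        fix y assume "y \<in> ?K"
        moreover obtain g where "g \<in> \<Gamma>" "infdist y \<Gamma> = dist y g"
          using infdist_attains_inf[OF \<open>closed \<Gamma>\<close> ne] by blast
        ultimately show "y \<in> \<Omega>"
          using \<epsilon>(2) by (force simp: dist_commute)
      qed
      show "x \<in> ?K"
        using x\<Gamma> \<epsilon> by simp
      fix y assume "y \<in> ?K" "y \<notin> interior ?K"
      have "open {y. infdist y \<Gamma> < \<epsilon>}"
        by (intro open_Collect_less continuous_intros)
      then have "{y. infdist y \<Gamma> < \<epsilon>} \<subseteq> interior ?K"
        by (intro interior_maximal) auto
      with \<open>y \<notin> interior ?K\<close> have "\<not> infdist y \<Gamma> < \<epsilon>"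
        by blast
      then show "y \<notin> \<Gamma> \<or> (y - x) \<bullet> (axis_form 0 0 1 (mat 1) *v (y - x)) < 0"
        using \<epsilon> by auto
    qed
  next
    assume F: "F = lam k"
      and "\<forall>x\<in>\<Gamma>. \<exists>r1>0. \<exists>r2>0. \<exists>h\<in>{1..k-1}. \<exists>Q::real^'n^'n. orthogonal_matrix Q \<and>
              (\<lambda>y. x + Q *v y) ` lateral h r1 r2 \<inter> \<Gamma> = {} \<and>
              (\<lambda>y. x + Q *v y) ` cylinder h r1 r2 \<subseteq> \<Omega>"
    then obtain r1 r2 h Q where r: "r1 > 0" "r2 > 0" and h: "h \<in> {1..k-1}"
      and Q: "orthogonal_matrix (Q::real^'n^'n)"
      and cyl: "(\<lambda>y. x + Q *v y) ` lateral h r1 r2 \<inter> \<Gamma> = {}"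
        "(\<lambda>y. x + Q *v y) ` cylinder h r1 r2 \<subseteq> \<Omega>"
      using x\<Gamma> by blast
    show False
    proof (rule no_min_cylinder[OF Q r _ cyl])
      fix t :: real assume t: "t > 0"
      then have "- (t * (1 / r1\<^sup>2)) \<le> 0" "0 < t * (1 / r2\<^sup>2)"
        using r by auto
      then show "F (axis_form h (t * (1 / r1\<^sup>2)) (t * (1 / r2\<^sup>2)) Q) > 0"
        using h assms(5,6) unfolding F by (subst lam_axis_form[OF Q]) auto
    qed
  next
    assume F: "F = Pminus k"
      and "\<forall>x\<in>\<Gamma>. \<exists>r1>0. \<exists>r2>0. \<exists>h\<in>{1..k-1}. \<exists>Q::real^'n^'n. orthogonal_matrix Q \<and>
              (r2 / r1)\<^sup>2 < real k / real h - 1 \<and>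
              (\<lambda>y. x + Q *v y) ` lateral h r1 r2 \<inter> \<Gamma> = {} \<and>
              (\<lambda>y. x + Q *v y) ` cylinder h r1 r2 \<subseteq> \<Omega>"
    then obtain r1 r2 h Q where r: "r1 > 0" "r2 > 0" and h: "h \<in> {1..k-1}"
      and Q: "orthogonal_matrix (Q::real^'n^'n)"
      and ratio: "(r2 / r1)\<^sup>2 < real k / real h - 1"
      and cyl: "(\<lambda>y. x + Q *v y) ` lateral h r1 r2 \<inter> \<Gamma> = {}"
        "(\<lambda>y. x + Q *v y) ` cylinder h r1 r2 \<subseteq> \<Omega>"
      using x\<Gamma> by blast
    show False
    proof (rule no_min_cylinder[OF Q r _ cyl])
      fix t :: real assume t: "t > 0"
      then have "- (t * (1 / r1\<^sup>2)) \<le> 0" "0 < t * (1 / r2\<^sup>2)"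
        using r by auto
      then have "F (axis_form h (t * (1 / r1\<^sup>2)) (t * (1 / r2\<^sup>2)) Q) =
          t * (real (k - h) * (1 / r2\<^sup>2) - real h * (1 / r1\<^sup>2))"
        using h assms(5,6) unfolding F by (subst Pminus_axis_form[OF Q]) (auto simp: algebra_simps)
      moreover have "real h * (r2 / r1)\<^sup>2 < real (k - h)"
        using ratio h by (simp add: field_simps of_nat_diff)
      then have "real h * (1 / r1\<^sup>2) < real (k - h) * (1 / r2\<^sup>2)"
        using r by (simp add: power_divide field_simps)
      ultimately show "F (axis_form h (t * (1 / r1\<^sup>2)) (t * (1 / r2\<^sup>2)) Q) > 0"
        using t by simp
    qed
  qed
qed

end
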